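(* For all integers $m\ge 1$ and $n\ge 1$, the average order $A(K_m\times P_n)$ of a connected set of $K_m\times P_n$ satisfies $$A(K_m\times P_n)=\frac{\sum_{k=1}^{n}(n-k+1)\Big\{mk\,f(m,k)-\sum_{i=1}^{m-1}\sum_{s=1}^{k}\binom{m}{i}(m-i)\,f_i(m,s)\,f_i(m,k+1-s)\Big\}}{\sum_{k=1}^{n}(n-k+1)f(m,k)}.$$
   Context: $K_m$ is the complete graph on $m$ vertices and $P_n$ the path on $n$ vertices. $K_m\times P_n$ denotes their Cartesian product: the vertices are $v_{k,j}$ with $1\le k\le n$, $1\le j\le m$, and $v_{k,j}$, $v_{k',j'}$ are adjacent iff either $k=k'$ and $j\ne j'$, or $j=j'$ and $|k-k'|=1$. The set $\{v_{k,1},\dots,v_{k,m}\}$ is called the $k$-th layer. A connected set of a graph $G$ is a nonempty vertex subset $M$ whose induced subgraph is connected. $N(G)$ is the number of connected sets of $G$, $S(G)$ is the sum of the orders $|M|$ over all connected sets $M$ of $G$, and $A(G)=S(G)/N(G)$. For $k\ge1$, $f(m,k)$ is the number of connected sets of $K_m\times P_k$ that contain at least one vertex of every one of the $k$ layers. For $1\le i\le m$ and $k\ge 1$, $f_i(m,k)$ is the number of connected sets of $K_m\times P_k$ that contain at least one vertex of each of the first $k-1$ layers and whose intersection with the $k$-th layer is exactly a given fixed set of $i$ vertices (this number does not depend on which $i$ vertices are fixed). *)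

theory Defs
  imports Complex_Main "Graph_Theory.Digraph_Component"
begin

text \<open>Undirected graphs are symmetric digraphs, as everywhere in the graph library used here.
  The vertex \<open>v\<^bsub>k,j\<^esub>\<close> is the pair \<open>(k, j)\<close>: first the layer, then the position in the layer.\<close>

definition KP :: "nat \<Rightarrow> nat \<Rightarrow> (nat \<times> nat) pair_pre_digraph" where
  "KP m n =
     \<lparr> pverts = {1..n} \<times> {1..m},
       parcs = {((k, j), (k', j')) | k j k' j'.
         k \<in> {1..n} \<and> j \<in> {1..m} \<and> k' \<in> {1..n} \<and> j' \<in> {1..m} \<and>
         (k = k' \<and> j \<noteq> j' \<or> j = j' \<and> \<bar>int k - int k'\<bar> = 1)} \<rparr>"

definition layer :: "nat \<Rightarrow> nat \<Rightarrow> (nat \<times> nat) set" where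
  "layer m k = {k} \<times> {1..m}"

text \<open>\<^const>\<open>Digraph_Component.connected\<close> is qualified because topological connectedness has the
  same base name.\<close>

definition connected_set :: "('a, 'b) pre_digraph \<Rightarrow> 'a set \<Rightarrow> bool" where
  "connected_set G M \<longleftrightarrow>
     M \<noteq> {} \<and> M \<subseteq> verts G \<and> Digraph_Component.connected (induce_subgraph G M)"

definition num_connected_sets :: "('a, 'b) pre_digraph \<Rightarrow> nat" where
  "num_connected_sets G = card {M. connected_set G M}"

definition total_order :: "('a, 'b) pre_digraph \<Rightarrow> nat" where
  "total_order G = (\<Sum>M | connected_set G M. card M)"

definition average_order :: "('a, 'b) pre_digraph \<Rightarrow> real" where
  "average_order G = real (total_order G) / real (num_connected_sets G)"

definition f :: "nat \<Rightarrow> nat \<Rightarrow> nat" where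
  "f m k = card {M. connected_set (KP m k) M \<and> (\<forall>l\<in>{1..k}. M \<inter> layer m l \<noteq> {})}"

definition f_fixed :: "nat \<Rightarrow> nat set \<Rightarrow> nat \<Rightarrow> nat" where
  "f_fixed m I k = card {M. connected_set (KP m k) M
     \<and> (\<forall>l\<in>{1..k - 1}. M \<inter> layer m l \<noteq> {}) \<and> M \<inter> layer m k = {k} \<times> I}"

text \<open>\<open>f_i i m k\<close> is \<open>f\<^sub>i(m, k)\<close>, for the fixed set of the first \<open>i\<close> vertices of the last layer.
  Lemma \<open>f_i_eq\<close> below shows that any other \<open>i\<close> vertices of that layer give the same number.\<close>

definition f_i :: "nat \<Rightarrow> nat \<Rightarrow> nat \<Rightarrow> nat" where
  "f_i i m k = f_fixed m {1..i} k"

lemma graph_KP: "graph (with_proj (KP m n))"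
proof -
  have "finite (parcs (KP m n))"
    by (rule finite_subset[of _ "({1..n} \<times> {1..m}) \<times> ({1..n} \<times> {1..m})"]) (auto simp: KP_def)
  then show ?thesis
    by unfold_locales
      (auto simp: KP_def arc_to_ends_def symmetric_def arcs_ends_conv sym_def)
qed

lemma finite_connected_sets: "finite {M. connected_set (with_proj (KP m n)) M}"
  by (rule finite_subset[of _ "Pow ({1..n} \<times> {1..m})"]) (auto simp: KP_def connected_set_def)

lemma connected_induce_image:
  assumes "Digraph_Component.connected (induce_subgraph (with_proj G) M)"
    and hom: "\<And>u v. (u, v) \<in> parcs G \<Longrightarrow> (\<phi> u, \<phi> v) \<in> parcs G"
  shows "Digraph_Component.connected (induce_subgraph (with_proj G) (\<phi> ` M))"
proof -
  let ?R = "\<lambda>M. (arcs_ends (induce_subgraph (with_proj G) M))\<^sup>s"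
  have R: "(u, v) \<in> ?R M \<longleftrightarrow> u \<in> M \<and> v \<in> M \<and> ((u, v) \<in> parcs G \<or> (v, u) \<in> parcs G)" for u v M
    by (auto simp: arcs_ends_conv symcl_def image_iff)
  have "(\<phi> u, \<phi> v) \<in> rtrancl_on (\<phi> ` M) (?R (\<phi> ` M))" if "(u, v) \<in> rtrancl_on M (?R M)" for u v
    using that
  proof (induction rule: rtrancl_on_induct)
    case base
    then show ?case by (auto intro: rtrancl_on_refl)
  next
    case (step y z)
    then have "(\<phi> y, \<phi> z) \<in> ?R (\<phi> ` M)" by (auto simp: R dest: hom)
    with step show ?case by (auto intro: rtrancl_on_into_rtrancl_on)
  qed
  with assms(1) show ?thesis by (auto simp: connected_conv)
qed

lemma f_fixed_le:
  assumes I: "I \<subseteq> {1..m}" and J: "J \<subseteq> {1..m}" and eq: "card I = card J"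
  shows "f_fixed m I k \<le> f_fixed m J k"
proof -
  have fin: "finite I" "finite J" using I J finite_subset by auto
  obtain g where g: "bij_betw g I J"
    using finite_same_card_bij[OF fin eq] by blast
  have "card ({1..m} - I) = card ({1..m} - J)"
    using I J fin eq by (simp add: card_Diff_subset)
  then obtain h where h: "bij_betw h ({1..m} - I) ({1..m} - J)"
    using finite_same_card_bij[of "{1..m} - I" "{1..m} - J"] by blast
  define p where "p = (\<lambda>x. if x \<in> I then g x else h x)"
  have p1: "bij_betw p I J"
    using g by (rule bij_betw_cong[THEN iffD1, rotated]) (simp add: p_def)
  have p2: "bij_betw p ({1..m} - I) ({1..m} - J)"
    using h by (rule bij_betw_cong[THEN iffD1, rotated]) (simp add: p_def)
  have p: "bij_betw p {1..m} {1..m}"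
    using bij_betw_combine[OF p1 p2] I J by (simp add: Un_absorb1)
  have pin: "p j \<in> {1..m}" if "j \<in> {1..m}" for j
    using p that by (meson bij_betwE)
  have pinj: "p j = p j' \<longleftrightarrow> j = j'" if "j \<in> {1..m}" "j' \<in> {1..m}" for j j'
    using p that by (meson bij_betw_imp_inj_on inj_on_eq_iff)
  define \<phi> where "\<phi> = map_prod (id :: nat \<Rightarrow> nat) p"
  have \<phi>: "\<phi> (a, b) = (a, p b)" for a b by (simp add: \<phi>_def)
  let ?V = "{1..k} \<times> {1..m}"
  let ?F = "\<lambda>I. {M. connected_set (with_proj (KP m k)) M
     \<and> (\<forall>l\<in>{1..k - 1}. M \<inter> layer m l \<noteq> {}) \<and> M \<inter> layer m k = {k} \<times> I}"
  have hom: "(\<phi> u, \<phi> v) \<in> parcs (KP m k)" if "(u, v) \<in> parcs (KP m k)" for u v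
    using that pin pinj by (auto simp: KP_def \<phi>)
  have inj: "inj_on \<phi> ?V"
    by (rule inj_onI) (use pinj in \<open>auto simp: \<phi>\<close>)
  have "\<phi> ` M \<in> ?F J" if M: "M \<in> ?F I" for M
  proof -
    have MV: "M \<subseteq> ?V" and ne: "M \<noteq> {}"
      and c: "Digraph_Component.connected (induce_subgraph (with_proj (KP m k)) M)"
      and ml: "\<forall>l\<in>{1..k - 1}. M \<inter> layer m l \<noteq> {}" and mk: "M \<inter> layer m k = {k} \<times> I"
      using M by (auto simp: connected_set_def KP_def)
    have img: "\<phi> ` M \<inter> layer m l = \<phi> ` (M \<inter> layer m l)" for l
    proof -
      have "\<phi> x \<in> layer m l \<longleftrightarrow> x \<in> layer m l" if "x \<in> M" for x
      proof -
        obtain a b where x: "x = (a, b)" by (rule prod.exhaust)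
        then have "b \<in> {1..m}" using that MV by blast
        then have "p b \<in> {1..m}" by (rule pin)
        with x \<open>b \<in> {1..m}\<close> show ?thesis
          by (simp only: \<phi> layer_def mem_Sigma_iff)
      qed
      then show ?thesis by blast
    qed
    have "p ` I = J" using p1 by (simp add: bij_betw_def)
    have "\<phi> ` ({k} \<times> I) = {k} \<times> p ` I"
      by (simp add: \<phi>_def map_prod_surj_on[OF refl refl])
    with \<open>p ` I = J\<close> have a: "\<phi> ` M \<inter> layer m k = {k} \<times> J"
      by (simp only: img mk)
    have b: "\<forall>l\<in>{1..k - 1}. \<phi> ` M \<inter> layer m l \<noteq> {}"
      using ml by (simp only: img image_is_empty)
    have "\<phi> ` M \<subseteq> ?V"
    proof
      fix x assume "x \<in> \<phi> ` M"
      then obtain a b where "(a, b) \<in> M" "x = (a, p b)" by (metis \<phi> imageE surj_pair)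
      then show "x \<in> ?V" using MV pin[of b] by blast
    qed
    then have "connected_set (with_proj (KP m k)) (\<phi> ` M)"
      using connected_induce_image[OF c hom] ne by (simp add: connected_set_def KP_def)
    with a b show ?thesis by blast
  qed
  then have "(`) \<phi> ` ?F I \<subseteq> ?F J" by blast
  moreover have "inj_on ((`) \<phi>) (?F I)"
    by (rule inj_on_subset[OF inj_on_image_Pow[OF inj]]) (auto simp: connected_set_def KP_def)
  moreover have "finite (?F J)"
    by (rule finite_subset[OF _ finite_connected_sets[of m k]]) auto
  ultimately show ?thesis
    unfolding f_fixed_def by (intro card_inj_on_le)
qed

lemma f_i_eq:
  assumes "I \<subseteq> {1..m}" "card I = i"
  shows "f_fixed m I k = f_i i m k"
proof -
  have "i \<le> m" using card_mono[OF _ assms(1)] assms(2) by simp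
  then have "{1..i} \<subseteq> {1..m}" "card {1..i} = card I" using assms by auto
  then show ?thesis
    using assms f_fixed_le[of I m "{1..i}" k] f_fixed_le[of "{1..i}" m I k]
    unfolding f_i_def by simp
qed

end

theory Submission
  imports Defs
begin

text \<open>The layers met by a connected set form an interval, so a connected set of \<open>K\<^sub>m \<times> P\<^sub>n\<close> is a
  translate of a connected set that meets every layer of some \<open>K\<^sub>m \<times> P\<^sub>k\<close>, and there are
  \<open>n - k + 1\<close> translates. For the latter sets count the missing vertices instead of the present
  ones: layers are cliques, so a set \<open>M\<close> whose intersection with the \<open>s\<close>-th layer is a fixed
  nonempty \<open>I\<close> is connected iff its parts up to and from layer \<open>s\<close> both are; reflecting
  the second part gives \<open>f\<^sub>i(m, s) f\<^sub>i(m, k + 1 - s)\<close> sets with \<open>m - i\<close> missing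
  vertices in layer \<open>s\<close>.\<close>

section \<open>Linked sets in the infinite grid of cliques\<close>

text \<open>Adjacency carries no bounds on layers or positions, so a set can be cut, shifted or
  reflected without changing the ambient graph.\<close>

definition adj :: "nat \<times> nat \<Rightarrow> nat \<times> nat \<Rightarrow> bool" where
  "adj u v \<longleftrightarrow> fst u = fst v \<and> snd u \<noteq> snd v
     \<or> snd u = snd v \<and> (fst v = Suc (fst u) \<or> fst u = Suc (fst v))"

definition steps :: "(nat \<times> nat) set \<Rightarrow> (nat \<times> nat) rel" where
  "steps M = {(u, v). u \<in> M \<and> v \<in> M \<and> adj u v}"

text \<open>The empty set counts as linked, which is why nonemptiness is a separate conjunct in
  \<open>connected_set_KP\<close>.\<close>

definition linked :: "(nat \<times> nat) set \<Rightarrow> bool" where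
  "linked M \<longleftrightarrow> (\<forall>u\<in>M. \<forall>v\<in>M. (u, v) \<in> (steps M)\<^sup>*)"

lemma rtrancl_on_eq_rtrancl:
  assumes "r \<subseteq> F \<times> F" "a \<in> F" "b \<in> F"
  shows "(a, b) \<in> rtrancl_on F r \<longleftrightarrow> (a, b) \<in> r\<^sup>*"
  using assms by (blast intro: rtrancl_on_rtranclI rtrancl_consistent_rtrancl_on)

text \<open>Within \<open>{1..n} \<times> {1..m}\<close> the arcs of \<open>KP m n\<close> are
  exactly the pairs in \<open>adj\<close>, which is symmetric, so the symmetric closure in the
  library notion adds nothing. Later connectivity arguments can therefore be about
  \<open>linked\<close> alone.\<close>

lemma connected_set_KP:
  "connected_set (with_proj (KP m n)) M \<longleftrightarrow> M \<noteq> {} \<and> M \<subseteq> {1..n} \<times> {1..m} \<and> linked M"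
proof -
  let ?R = "(arcs_ends (induce_subgraph (with_proj (KP m n)) M))\<^sup>s"
  have R: "(u, v) \<in> ?R \<longleftrightarrow> u \<in> M \<and> v \<in> M \<and> ((u, v) \<in> parcs (KP m n) \<or> (v, u) \<in> parcs (KP m n))"
    for u v
    by (cases u; cases v) (auto simp: arcs_ends_conv symcl_def image_iff)
  have "?R = steps M" if "M \<subseteq> {1..n} \<times> {1..m}"
  proof -
    have "(u, v) \<in> ?R \<longleftrightarrow> (u, v) \<in> steps M" for u v
      unfolding R using that by (cases u; cases v) (auto simp: KP_def steps_def adj_def)
    then show ?thesis by auto
  qed
  moreover have "steps M \<subseteq> M \<times> M" by (auto simp: steps_def)
  ultimately show ?thesis
    by (auto simp: connected_set_def connected_conv linked_def rtrancl_on_eq_rtrancl KP_def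
        cong: conj_cong)
qed

lemma steps_mono: "M \<subseteq> N \<Longrightarrow> steps M \<subseteq> steps N"
  by (auto simp: steps_def)

text \<open>A step whose two ends are identified simply drops out of the image path, so collapsing
  maps qualify. Since \<open>hom\<close> concerns only vertices of \<open>M\<close>, bounds on
  \<open>M\<close> can rule out truncated subtraction in reflections and translations.\<close>

lemma linked_image:
  assumes "linked M"
    and hom: "\<And>u v. u \<in> M \<Longrightarrow> v \<in> M \<Longrightarrow> adj u v \<Longrightarrow> \<phi> u = \<phi> v \<or> adj (\<phi> u) (\<phi> v)"
  shows "linked (\<phi> ` M)"
proof -
  have "(\<phi> u, \<phi> v) \<in> (steps (\<phi> ` M))\<^sup>*" if "(u, v) \<in> (steps M)\<^sup>*" for u v
    using that
  proof (induction rule: rtrancl_induct)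
    case (step y z)
    then have "\<phi> y = \<phi> z \<or> (\<phi> y, \<phi> z) \<in> steps (\<phi> ` M)"
      using hom by (auto simp: steps_def)
    with step.IH show ?case by (metis rtrancl.rtrancl_into_rtrancl)
  qed simp
  with assms(1) show ?thesis by (auto simp: linked_def)
qed

lemma linked_Un:
  assumes "linked A" "linked B" "A \<inter> B \<noteq> {}"
  shows "linked (A \<union> B)"
proof -
  let ?R = "(steps (A \<union> B))\<^sup>*"
  obtain c where c: "c \<in> A" "c \<in> B" using assms(3) by auto
  have sub: "(steps A)\<^sup>* \<subseteq> ?R" "(steps B)\<^sup>* \<subseteq> ?R"
    by (intro rtrancl_mono steps_mono; blast)+
  have "(u, c) \<in> ?R \<and> (c, u) \<in> ?R" if "u \<in> A \<union> B" for u
    using that assms(1,2) c sub unfolding linked_def by blast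
  then show ?thesis unfolding linked_def by (meson rtrancl_trans)
qed

text \<open>A step changes the layer by at most one, so a path that starts below an empty layer
  \<open>l\<close> can never get past it.\<close>

lemma linked_meets_between:
  assumes "linked M" "(a, i) \<in> M" "(b, j) \<in> M" "a \<le> l" "l \<le> b"
  shows "\<exists>x. (l, x) \<in> M"
proof (rule ccontr)
  assume none: "\<nexists>x. (l, x) \<in> M"
  have "((a, i), (b, j)) \<in> (steps M)\<^sup>*" using assms(1-3) by (auto simp: linked_def)
  then have "fst (b, j) < l"
  proof (induction rule: rtrancl_induct)
    case base
    show ?case using none assms(2,4) by (auto simp: le_less)
  next
    case (step y z)
    then have "fst z \<le> l" "z \<in> M" by (auto simp: steps_def adj_def)
    then show ?case using none by (cases z) (auto simp: le_less)
  qed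
  with assms(5) show False by simp
qed

text \<open>The part of a linked set beyond layer \<open>s\<close> can be collapsed to one vertex of layer \<open>s\<close>,
  because edges into layer \<open>s\<close> then become edges of a clique or loops.\<close>

lemma linked_cut:
  assumes "linked M" "(s, i) \<in> M"
  shows "linked (M \<inter> {..s} \<times> UNIV)" and "linked (M \<inter> {s..} \<times> UNIV)"
proof -
  let ?lo = "\<lambda>x. if fst x \<le> s then x else (s, i)"
  let ?hi = "\<lambda>x. if s \<le> fst x then x else (s, i)"
  have "linked (?lo ` M)" "linked (?hi ` M)"
    by (rule linked_image[OF assms(1)]; auto simp: adj_def prod_eq_iff)+
  moreover have "?lo ` M = M \<inter> {..s} \<times> UNIV" "?hi ` M = M \<inter> {s..} \<times> UNIV"
    using assms(2) by force+
  ultimately show "linked (M \<inter> {..s} \<times> UNIV)" "linked (M \<inter> {s..} \<times> UNIV)" by simp_all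
qed

section \<open>Sets meeting every layer\<close>

definition full :: "nat \<Rightarrow> nat \<Rightarrow> (nat \<times> nat) set set" where
  "full m k = {M. M \<subseteq> {1..k} \<times> {1..m} \<and> linked M \<and> (\<forall>l\<in>{1..k}. \<exists>j. (l, j) \<in> M)}"

text \<open>The preimage under \<open>Pair k\<close> is the set of positions that \<open>M\<close>
  occupies in layer \<open>k\<close>.\<close>

definition ended :: "nat \<Rightarrow> nat set \<Rightarrow> nat \<Rightarrow> (nat \<times> nat) set set" where
  "ended m I k = {M \<in> full m k. Pair k -` M = I}"

lemma finite_full: "finite (full m k)"
  by (rule finite_subset[of _ "Pow ({1..k} \<times> {1..m})"]) (auto simp: full_def)

lemma meets_layer_iff:
  "M \<subseteq> {1..k} \<times> {1..m} \<Longrightarrow> M \<inter> layer m l \<noteq> {} \<longleftrightarrow> (\<exists>j. (l, j) \<in> M)"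
  by (auto simp: layer_def)

text \<open>The bound on \<open>k\<close> matters: the empty set lies in \<open>full m 0\<close> but
  is not a connected set.\<close>

lemma f_eq_card_full:
  assumes "k \<ge> 1"
  shows "f m k = card (full m k)"
proof -
  have "M \<noteq> {}" if "\<forall>l\<in>{1..k}. \<exists>j. (l, j) \<in> M" for M :: "(nat \<times> nat) set"
    using that assms by force
  then have "connected_set (KP m k) M \<and> (\<forall>l\<in>{1..k}. M \<inter> layer m l \<noteq> {}) \<longleftrightarrow> M \<in> full m k" for M
    unfolding full_def connected_set_KP mem_Collect_eq using meets_layer_iff[of M k m] by blast
  then show ?thesis by (simp add: f_def)
qed

text \<open>Membership in \<open>full\<close> also asks that layer \<open>k\<close> be met; a
  nonempty \<open>I\<close> guarantees this. For empty \<open>I\<close>, \<open>f_fixed\<close>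
  would count sets that stop before layer \<open>k\<close>.\<close>

lemma f_fixed_eq_card_ended:
  assumes "k \<ge> 1" "I \<noteq> {}"
  shows "f_fixed m I k = card (ended m I k)"
proof -
  have "connected_set (KP m k) M \<and> (\<forall>l\<in>{1..k - 1}. M \<inter> layer m l \<noteq> {})
      \<and> M \<inter> layer m k = {k} \<times> I \<longleftrightarrow> M \<in> ended m I k" for M
  proof (cases "M \<subseteq> {1..k} \<times> {1..m}")
    case True
    then have last: "M \<inter> layer m k = {k} \<times> I \<longleftrightarrow> Pair k -` M = I"
      by (auto simp: layer_def)
    have "{1..k} = insert k {1..k - 1}" using assms(1) by auto
    moreover have "(\<exists>j. (k, j) \<in> M) \<and> M \<noteq> {}" if "Pair k -` M = I"
      using that assms(2) by auto
    ultimately show ?thesis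
      unfolding last ended_def full_def connected_set_KP
      using True by (auto simp: meets_layer_iff[OF True] simp del: Int_iff)
  next
    case False
    then show ?thesis unfolding ended_def full_def connected_set_KP by blast
  qed
  then show ?thesis by (simp add: f_fixed_def)
qed

section \<open>Reflection of the order of the layers\<close>

definition flip :: "nat \<Rightarrow> (nat \<times> nat) set \<Rightarrow> (nat \<times> nat) set" where
  "flip k M = (\<lambda>(l, j). (k + 1 - l, j)) ` M"

text \<open>On \<open>{1..k}\<close> the map from \<open>l\<close> to \<open>k + 1 - l\<close> is
  its own inverse; layers beyond \<open>k\<close> would all be truncated to 0.\<close>

lemma mem_flip_iff:
  assumes "M \<subseteq> {1..k} \<times> UNIV"
  shows "(l, j) \<in> flip k M \<longleftrightarrow> l \<in> {1..k} \<and> (k + 1 - l, j) \<in> M"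
proof
  assume "(l, j) \<in> flip k M"
  with assms show "l \<in> {1..k} \<and> (k + 1 - l, j) \<in> M" by (force simp: flip_def)
next
  assume "l \<in> {1..k} \<and> (k + 1 - l, j) \<in> M"
  then show "(l, j) \<in> flip k M" unfolding flip_def
    by (intro image_eqI[of _ _ "(k + 1 - l, j)"]) auto
qed

text \<open>A set living in the first \<open>k + 1 - s\<close> layers is moved to the layers from
  \<open>s\<close> to \<open>k\<close>, where it serves as the upper piece of a gluing.\<close>

lemma mem_flip_above:
  assumes s: "s \<in> {1..k}" and B: "B \<subseteq> {1..k + 1 - s} \<times> J"
  shows "(l, j) \<in> flip k B \<longleftrightarrow> s \<le> l \<and> l \<le> k \<and> (k + 1 - l, j) \<in> B"
proof -
  have "s \<le> l" if "(k + 1 - l, j) \<in> B"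
    using subsetD[OF B that] s by auto
  moreover have "B \<subseteq> {1..k} \<times> UNIV" using B s by force
  ultimately show ?thesis using s by (auto simp: mem_flip_iff)
qed

lemma flip_flip:
  assumes "M \<subseteq> {1..k} \<times> UNIV"
  shows "flip k (flip k M) = M"
proof -
  have "flip k (flip k M) = (\<lambda>x. x) ` M"
    unfolding flip_def image_image by (rule image_cong) (use assms in auto)
  then show ?thesis by simp
qed

lemma linked_flip: "linked M \<Longrightarrow> M \<subseteq> {1..k} \<times> UNIV \<Longrightarrow> linked (flip k M)"
  unfolding flip_def by (rule linked_image) (auto simp: adj_def)

text \<open>Cutting at layer \<open>s\<close> and gluing there are inverse bijections. Both pieces
  keep layer \<open>s\<close>, so they overlap in \<open>I\<close>; a vertex of this overlap makes
  the glued set linked. Reflection turns layer \<open>s\<close> into the last layer of the upper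
  piece, so \<open>ended\<close> counts that piece too.\<close>

lemma card_full_fixed_layer:
  assumes s: "s \<in> {1..k}" and I: "I \<noteq> {}"
  shows "card {M \<in> full m k. Pair s -` M = I} = card (ended m I s) * card (ended m I (k + 1 - s))"
proof -
  let ?S = "{M \<in> full m k. Pair s -` M = I}"
  let ?A = "ended m I s" and ?B = "ended m I (k + 1 - s)"
  \<comment> \<open>The reflection is the one of all \<open>k\<close> layers: it sends layer
    \<open>k\<close> to 1 and layer \<open>s\<close> to \<open>k + 1 - s\<close>.\<close>
  let ?cut = "\<lambda>M. (M \<inter> {..s} \<times> UNIV, flip k (M \<inter> {s..} \<times> UNIV))"
  let ?glue = "\<lambda>(A, B). A \<union> flip k B"
  obtain i where i: "i \<in> I" using I by auto
  \<comment> \<open>Facts \<open>1\<close> to \<open>4\<close> are the premises of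
    \<open>bij_betw_byWitness\<close>: both compositions are identities, and each map lands in the
    other set.\<close>
  have 1: "?glue (?cut M) = M" if "M \<in> ?S" for M
  proof -
    have *: "M \<inter> {s..} \<times> UNIV \<subseteq> {1..k} \<times> UNIV"
      using that by (auto simp: full_def)
    have "M \<inter> {..s} \<times> UNIV \<union> M \<inter> {s..} \<times> UNIV = M" by auto
    with flip_flip[OF *] show ?thesis by simp
  qed
  have 2: "?cut (?glue p) = p" if "p \<in> ?A \<times> ?B" for p
  proof -
    obtain A B where p: "p = (A, B)" by fastforce
    have A: "A \<subseteq> {1..s} \<times> {1..m}" "Pair s -` A = I"
      and B: "B \<subseteq> {1..k + 1 - s} \<times> {1..m}" "Pair (k + 1 - s) -` B = I"
      using that p by (auto simp: ended_def full_def)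
    have Bk: "B \<subseteq> {1..k} \<times> UNIV" using B(1) s by force
    have flip: "(l, j) \<in> flip k B \<longleftrightarrow> s \<le> l \<and> l \<le> k \<and> (k + 1 - l, j) \<in> B" for l j
      by (rule mem_flip_above[OF s B(1)])
    \<comment> \<open>Both pieces occupy exactly \<open>I\<close> in the shared layer, so neither
      adds a vertex there to the other when the glued set is cut again.\<close>
    have B': "(k + 1 - s, j) \<in> B \<longleftrightarrow> (s, j) \<in> A" for j using A(2) B(2) by auto
    have lo: "(A \<union> flip k B) \<inter> {..s} \<times> UNIV = A"
    proof -
      have "(l, j) \<in> (A \<union> flip k B) \<inter> {..s} \<times> UNIV \<longleftrightarrow> (l, j) \<in> A" for l j
        using A(1) B'[of j] by (cases "l = s") (auto simp: flip)
      then show ?thesis by auto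
    qed
    have "(l, j) \<in> (A \<union> flip k B) \<inter> {s..} \<times> UNIV \<longleftrightarrow> (l, j) \<in> flip k B" for l j
      using A(1) B'[of j] s by (cases "l = s") (auto simp: flip)
    then have "(A \<union> flip k B) \<inter> {s..} \<times> UNIV = flip k B" by auto
    then show ?thesis using lo by (simp add: p flip_flip[OF Bk])
  qed
  have 3: "?cut ` ?S \<subseteq> ?A \<times> ?B"
  proof (rule image_subsetI)
    fix M assume M: "M \<in> ?S"
    then have Mk: "M \<subseteq> {1..k} \<times> {1..m}" and lM: "linked M"
      and Ml: "\<And>l. l \<in> {1..k} \<Longrightarrow> \<exists>j. (l, j) \<in> M" and Ms: "Pair s -` M = I"
      by (auto simp: full_def)
    have si: "(s, i) \<in> M" using i Ms by auto
    let ?hi = "M \<inter> {s..} \<times> UNIV"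
    have hi: "?hi \<subseteq> {1..k} \<times> UNIV" using Mk by auto
    have flip: "(l, j) \<in> flip k ?hi \<longleftrightarrow> 1 \<le> l \<and> l \<le> k + 1 - s \<and> (k + 1 - l, j) \<in> M" for l j
      using s by (auto simp: mem_flip_iff[OF hi])
    have "M \<inter> {..s} \<times> UNIV \<in> ?A"
      using Mk Ml Ms s linked_cut(1)[OF lM si] by (auto simp: ended_def full_def)
    moreover have "linked (flip k ?hi)"
      using linked_flip[OF linked_cut(2)[OF lM si] hi] .
    moreover have "flip k ?hi \<subseteq> {1..k + 1 - s} \<times> {1..m}"
      using Mk by (auto simp: flip)
    moreover have "\<exists>j. (l, j) \<in> flip k ?hi" if "l \<in> {1..k + 1 - s}" for l
    proof -
      have "k + 1 - l \<in> {1..k}" using that s by auto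
      then show ?thesis using Ml[of "k + 1 - l"] that by (auto simp: flip)
    qed
    moreover have "Pair (k + 1 - s) -` flip k ?hi = I"
      using Ms s by (auto simp: flip)
    ultimately show "?cut M \<in> ?A \<times> ?B" by (auto simp: ended_def full_def)
  qed
  have 4: "?glue ` (?A \<times> ?B) \<subseteq> ?S"
  proof (rule image_subsetI)
    fix p assume "p \<in> ?A \<times> ?B"
    then obtain A B where p: "p = (A, B)" and AB: "A \<in> ?A" "B \<in> ?B" by auto
    have A: "A \<subseteq> {1..s} \<times> {1..m}" "Pair s -` A = I" "linked A"
        "\<And>l. l \<in> {1..s} \<Longrightarrow> \<exists>j. (l, j) \<in> A"
      and B: "B \<subseteq> {1..k + 1 - s} \<times> {1..m}" "Pair (k + 1 - s) -` B = I" "linked B"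
        "\<And>l. l \<in> {1..k + 1 - s} \<Longrightarrow> \<exists>j. (l, j) \<in> B"
      using AB by (auto simp: ended_def full_def)
    have Bk: "B \<subseteq> {1..k} \<times> UNIV" using B(1) s by force
    have flip: "(l, j) \<in> flip k B \<longleftrightarrow> s \<le> l \<and> l \<le> k \<and> (k + 1 - l, j) \<in> B" for l j
      by (rule mem_flip_above[OF s B(1)])
    have "(s, i) \<in> A" "(s, i) \<in> flip k B" using A(2) B(2) i s by (auto simp: flip)
    then have "linked (A \<union> flip k B)"
      using linked_Un[OF A(3) linked_flip[OF B(3) Bk]] by auto
    moreover have "A \<union> flip k B \<subseteq> {1..k} \<times> {1..m}"
      using A(1) B(1) s by (fastforce simp: flip)
    moreover have "\<exists>j. (l, j) \<in> A \<union> flip k B" if "l \<in> {1..k}" for l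
    proof (cases "l \<le> s")
      case True
      then show ?thesis using A(4)[of l] that by auto
    next
      case False
      then have "k + 1 - l \<in> {1..k + 1 - s}" using that by auto
      then show ?thesis using B(4)[of "k + 1 - l"] that False by (auto simp: flip)
    qed
    moreover have "Pair s -` (A \<union> flip k B) = I"
      using A(2) B(2) s by (auto simp: flip)
    ultimately show "?glue p \<in> ?S" by (auto simp: p full_def)
  qed
  have "bij_betw ?cut ?S (?A \<times> ?B)"
    using 1 2 3 4 by (intro bij_betw_byWitness[where f' = ?glue]) blast+
  then have "card ?S = card (?A \<times> ?B)" by (rule bij_betw_same_card)
  then show ?thesis by (simp only: card_cartesian_product)
qed

text \<open>The sets are grouped by their trace \<open>I\<close> on layer \<open>s\<close>, and the
  traces by their size: by \<open>f_i_eq\<close> the size of a group depends only on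
  \<open>card I\<close>.\<close>

lemma sum_missing_full_layer:
  assumes s: "s \<in> {1..k}"
  shows "(\<Sum>M\<in>full m k. real m - real (card (Pair s -` M))) =
    (\<Sum>i = 1..m - 1. real (m choose i) * (real m - real i) * real (f_i i m s) * real (f_i i m (k + 1 - s)))"
proof -
  \<comment> \<open>The empty trace is excluded because sets in \<open>full m k\<close> meet layer
    \<open>s\<close>.\<close>
  let ?P = "Pow {1..m} - {{}}"
  let ?t = "\<lambda>i. (real m - real i) * real (f_i i m s) * real (f_i i m (k + 1 - s))"
  have "Pair s -` M \<in> ?P" if "M \<in> full m k" for M
  proof -
    have "M \<subseteq> {1..k} \<times> {1..m}" "\<exists>j. (s, j) \<in> M" using that s by (auto simp: full_def)
    then show ?thesis by blast
  qed
  then have "(\<Sum>M\<in>full m k. real m - real (card (Pair s -` M))) =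
      (\<Sum>I\<in>?P. \<Sum>M | M \<in> full m k \<and> Pair s -` M = I. real m - real (card (Pair s -` M)))"
    by (intro sum.group[symmetric] finite_full) auto
  also have "\<dots> = (\<Sum>I\<in>?P. ?t (card I))"
  proof (rule sum.cong[OF refl])
    fix I assume I: "I \<in> ?P"
    then have "card (ended m I t) = f_i (card I) m t" if "t \<ge> 1" for t
      using that f_fixed_eq_card_ended[of t I m] f_i_eq[of I m "card I" t] by auto
    moreover have "s \<ge> 1" "k + 1 - s \<ge> 1" using s by auto
    ultimately have "card {M \<in> full m k. Pair s -` M = I} = f_i (card I) m s * f_i (card I) m (k + 1 - s)"
      using card_full_fixed_layer[OF s, of I m] I by simp
    then show "(\<Sum>M | M \<in> full m k \<and> Pair s -` M = I. real m - real (card (Pair s -` M))) = ?t (card I)"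
      by simp
  qed
  also have "\<dots> = (\<Sum>i = 1..m. \<Sum>I | I \<in> ?P \<and> card I = i. ?t (card I))"
  proof (rule sum.group[symmetric])
    show "card ` ?P \<subseteq> {1..m}"
    proof (rule image_subsetI)
      fix I assume "I \<in> ?P"
      then have "finite I" "I \<noteq> {}" "card I \<le> card {1..m}"
        using card_mono[of "{1..m}" I] by (auto intro: finite_subset)
      then show "card I \<in> {1..m}" by (simp add: Suc_le_eq card_gt_0_iff)
    qed
  qed auto
  also have "\<dots> = (\<Sum>i = 1..m. real (m choose i) * ?t i)"
  proof (rule sum.cong[OF refl])
    fix i assume "i \<in> {1..m}"
    then have "{I. I \<in> ?P \<and> card I = i} = {I. I \<subseteq> {1..m} \<and> card I = i}" by auto
    then have "card {I. I \<in> ?P \<and> card I = i} = m choose i" by (simp add: n_subsets)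
    then show "(\<Sum>I | I \<in> ?P \<and> card I = i. ?t (card I)) = real (m choose i) * ?t i"
      by simp
  qed
  \<comment> \<open>For \<open>i = m\<close> no vertex of the layer is missing, and the factor
    \<open>real m - real i\<close> is 0.\<close>
  also have "\<dots> = (\<Sum>i = 1..m - 1. real (m choose i) * ?t i)"
  proof (rule sum.mono_neutral_right)
    have "i = m" if "i \<in> {1..m} - {1..m - 1}" for i using that by auto
    then show "\<forall>i\<in>{1..m} - {1..m - 1}. real (m choose i) * ?t i = 0" by fastforce
  qed auto
  finally show ?thesis by (simp add: mult.assoc)
qed

text \<open>A set has \<open>m * k\<close> vertices minus those missing, counted layer by layer. The
  first exchange of sums isolates a layer for \<open>sum_missing_full_layer\<close>; the second
  restores the order of summation over \<open>i\<close> and \<open>s\<close>.\<close>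

lemma sum_card_full:
  "(\<Sum>M\<in>full m k. real (card M)) = real m * real k * real (card (full m k))
    - (\<Sum>i = 1..m - 1. \<Sum>s = 1..k.
         real (m choose i) * (real m - real i) * real (f_i i m s) * real (f_i i m (k + 1 - s)))"
proof -
  have "real (card M) = real m * real k - (\<Sum>s = 1..k. real m - real (card (Pair s -` M)))"
    if "M \<in> full m k" for M
  proof -
    have sub: "M \<subseteq> {1..k} \<times> {1..m}" using that by (auto simp: full_def)
    have "finite (Pair s -` M)" for s
      by (rule finite_subset[of _ "{1..m}"]) (use sub in auto)
    then have "card (Sigma {1..k} (\<lambda>s. Pair s -` M)) = (\<Sum>s = 1..k. card (Pair s -` M))" by simp
    moreover have "Sigma {1..k} (\<lambda>s. Pair s -` M) = M" using sub by auto
    ultimately show ?thesis by (simp add: sum_subtractf)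
  qed
  then have "(\<Sum>M\<in>full m k. real (card M)) =
      (\<Sum>M\<in>full m k. real m * real k - (\<Sum>s = 1..k. real m - real (card (Pair s -` M))))"
    by (rule sum.cong[OF refl])
  also have "\<dots> = real m * real k * real (card (full m k))
      - (\<Sum>M\<in>full m k. \<Sum>s = 1..k. real m - real (card (Pair s -` M)))"
    by (subst sum_subtractf) simp
  also have "(\<Sum>M\<in>full m k. \<Sum>s = 1..k. real m - real (card (Pair s -` M))) =
      (\<Sum>s = 1..k. \<Sum>M\<in>full m k. real m - real (card (Pair s -` M)))"
    by (rule sum.swap)
  also have "\<dots> = (\<Sum>s = 1..k. \<Sum>i = 1..m - 1.
      real (m choose i) * (real m - real i) * real (f_i i m s) * real (f_i i m (k + 1 - s)))"
    by (intro sum.cong[OF refl] sum_missing_full_layer)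
  also have "\<dots> = (\<Sum>i = 1..m - 1. \<Sum>s = 1..k.
      real (m choose i) * (real m - real i) * real (f_i i m s) * real (f_i i m (k + 1 - s)))"
    by (rule sum.swap)
  finally show ?thesis .
qed

section \<open>Translates\<close>

definition shift :: "nat \<Rightarrow> (nat \<times> nat) set \<Rightarrow> (nat \<times> nat) set" where
  "shift a M = (\<lambda>(l, j). (l + a, j)) ` M"

lemma mem_shift_iff: "(l, j) \<in> shift a M \<longleftrightarrow> a \<le> l \<and> (l - a, j) \<in> M"
  by (force simp: shift_def)

lemma card_shift: "card (shift a M) = card M"
  unfolding shift_def by (rule card_image) (auto simp: inj_on_def)

lemma linked_shift: "linked M \<Longrightarrow> linked (shift a M)"
  unfolding shift_def by (rule linked_image) (auto simp: adj_def)

lemma fst_full: "M \<in> full m k \<Longrightarrow> fst ` M = {1..k}"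
  by (force simp: full_def image_iff)

text \<open>The occupied layers of \<open>shift a M\<close> are \<open>{a + 1..a + k}\<close>. This
  interval is nonempty by \<open>k \<ge> 1\<close>, so it determines both \<open>a\<close> and
  \<open>k\<close>.\<close>

lemma shift_inject:
  assumes M: "M \<in> full m k" "M' \<in> full m k'" and k: "k \<ge> 1" and eq: "shift a M = shift a' M'"
  shows "k = k' \<and> a = a' \<and> M = M'"
proof -
  have "fst ` shift a M = {a + 1..a + k}" "fst ` shift a' M' = {a' + 1..a' + k'}"
  proof -
    have "fst ` shift b N = (+) b ` fst ` N" for b N by (force simp: shift_def)
    then show "fst ` shift a M = {a + 1..a + k}" "fst ` shift a' M' = {a' + 1..a' + k'}"
      using fst_full[OF M(1)] fst_full[OF M(2)] by simp_all
  qed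
  then have "{a + 1..a + k} = {a' + 1..a' + k'}" using eq by metis
  then have a: "a = a'" "k = k'" using k unfolding Icc_eq_Icc by linarith+
  have "(l, j) \<in> M \<longleftrightarrow> (l, j) \<in> M'" for l j
  proof -
    have "(l + a, j) \<in> shift a M \<longleftrightarrow> (l + a, j) \<in> shift a' M'" using eq by simp
    then show ?thesis using a by (simp add: mem_shift_iff)
  qed
  then show ?thesis using a by auto
qed

text \<open>By \<open>linked_meets_between\<close> the occupied layers fill the interval from the
  lowest, \<open>lo\<close>, to the highest, \<open>hi\<close>; lowering the set by
  \<open>lo - 1\<close> makes layer 1 its first.\<close>

lemma obtain_full_shift:
  assumes "M \<noteq> {}" "M \<subseteq> {1..n} \<times> {1..m}" "linked M"
  obtains k a N where "k \<in> {1..n}" "a < n + 1 - k" "N \<in> full m k" "M = shift a N"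
proof -
  let ?L = "fst ` M"
  have "finite M" by (rule finite_subset[OF assms(2)]) simp
  then have fin: "finite ?L" by simp
  have ne: "?L \<noteq> {}" using assms(1) by simp
  define lo hi where "lo = Min ?L" and "hi = Max ?L"
  have "lo \<in> ?L" "hi \<in> ?L" unfolding lo_def hi_def using fin ne by simp_all
  then obtain i j where ij: "(lo, i) \<in> M" "(hi, j) \<in> M" by auto
  have bd: "lo \<le> l \<and> l \<le> hi" if "(l, x) \<in> M" for l x
  proof -
    have "l \<in> ?L" using that by force
    with fin show ?thesis unfolding lo_def hi_def by simp
  qed
  have lohi: "1 \<le> lo" "lo \<le> hi" "hi \<le> n" using assms(2) ij bd[OF ij(1)] by auto
  define N where "N = (\<lambda>(l, x). (l - (lo - 1), x)) ` M"
  \<comment> \<open>No layer of \<open>M\<close> lies below \<open>lo\<close>, so the subtraction in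
    \<open>N\<close> is never truncated.\<close>
  have N: "(l, x) \<in> N \<longleftrightarrow> 1 \<le> l \<and> (l + (lo - 1), x) \<in> M" for l x
  proof
    assume "(l, x) \<in> N"
    then obtain l' where "(l', x) \<in> M" "l = l' - (lo - 1)" by (auto simp: N_def)
    then show "1 \<le> l \<and> (l + (lo - 1), x) \<in> M"
      using bd[of l' x] lohi(1) by auto
  next
    assume "1 \<le> l \<and> (l + (lo - 1), x) \<in> M"
    then show "(l, x) \<in> N" unfolding N_def
      by (intro image_eqI[of _ _ "(l + (lo - 1), x)"]) auto
  qed
  have "linked N" unfolding N_def
  proof (rule linked_image[OF assms(3)])
    fix u v assume "u \<in> M" "v \<in> M" "adj u v"
    then show "(case u of (l, x) \<Rightarrow> (l - (lo - 1), x)) = (case v of (l, x) \<Rightarrow> (l - (lo - 1), x))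
        \<or> adj (case u of (l, x) \<Rightarrow> (l - (lo - 1), x)) (case v of (l, x) \<Rightarrow> (l - (lo - 1), x))"
      using bd[of "fst u" "snd u"] bd[of "fst v" "snd v"] lohi(1)
      by (cases u; cases v) (auto simp: adj_def)
  qed
  moreover have "N \<subseteq> {1..hi + 1 - lo} \<times> {1..m}"
  proof -
    have "l \<in> {1..hi + 1 - lo} \<and> x \<in> {1..m}" if "(l, x) \<in> N" for l x
      using that assms(2) bd[of "l + (lo - 1)" x] lohi by (auto simp: N)
    then show ?thesis by auto
  qed
  moreover have "\<exists>x. (l, x) \<in> N" if "l \<in> {1..hi + 1 - lo}" for l
    using linked_meets_between[OF assms(3) ij, of "l + (lo - 1)"] that lohi by (auto simp: N)
  ultimately have "N \<in> full m (hi + 1 - lo)" by (simp add: full_def)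
  moreover have "M = shift (lo - 1) N"
  proof -
    have "(l, x) \<in> M \<longleftrightarrow> (l, x) \<in> shift (lo - 1) N" for l x
      using bd[of l x] lohi(1) by (auto simp: mem_shift_iff N)
    then show ?thesis by auto
  qed
  moreover have "hi + 1 - lo \<in> {1..n}" "lo - 1 < n + 1 - (hi + 1 - lo)" using lohi by auto
  ultimately show thesis using that by blast
qed

text \<open>The weight \<open>g\<close> is arbitrary so that one reindexing serves both the total
  order and the number of connected sets.\<close>

lemma sum_connected_sets_KP:
  fixes g :: "nat \<Rightarrow> real"
  shows "(\<Sum>M | connected_set (with_proj (KP m n)) M. g (card M)) =
    (\<Sum>k = 1..n. (real n - real k + 1) * (\<Sum>M\<in>full m k. g (card M)))"
proof -
  \<comment> \<open>A triple holds the number \<open>k\<close> of occupied layers, the offset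
    \<open>a\<close> and the untranslated set; the offsets from 0 to \<open>n - k\<close> are those
    that stay within \<open>n\<close> layers.\<close>
  let ?X = "Sigma {1..n} (\<lambda>k. {..<n + 1 - k} \<times> full m k)"
  let ?h = "\<lambda>(k, a, M). shift a M"
  have "inj_on ?h ?X"
  proof (rule inj_onI)
    fix p q assume pq: "p \<in> ?X" "q \<in> ?X" "?h p = ?h q"
    obtain k a M k' a' M' where "p = (k, a, M)" "q = (k', a', M')" by (metis prod_cases3)
    with pq show "p = q" using shift_inject[of M m k M' k' a a'] by auto
  qed
  moreover have "?h ` ?X = {M. connected_set (with_proj (KP m n)) M}"
  proof (intro equalityI subsetI)
    fix M assume "M \<in> ?h ` ?X"
    then obtain k a N where N: "k \<in> {1..n}" "a < n + 1 - k" "N \<in> full m k" "M = shift a N"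
      by auto
    have "N \<noteq> {}" using fst_full[OF N(3)] N(1) by auto
    then have "M \<noteq> {}" by (simp add: N(4) shift_def)
    moreover have "l + a \<in> {1..n}" if "l \<in> {1..k}" for l using that N(1,2) by auto
    then have "M \<subseteq> {1..n} \<times> {1..m}"
      using N(3) by (auto simp: N(4) full_def shift_def)
    moreover have "linked M" using N(3,4) linked_shift by (auto simp: full_def)
    ultimately show "M \<in> {M. connected_set (with_proj (KP m n)) M}"
      by (simp add: connected_set_KP)
  next
    fix M assume "M \<in> {M. connected_set (with_proj (KP m n)) M}"
    then have "M \<noteq> {}" "M \<subseteq> {1..n} \<times> {1..m}" "linked M"
      by (simp_all add: connected_set_KP)
    then obtain k a N where "k \<in> {1..n}" "a < n + 1 - k" "N \<in> full m k" "M = shift a N"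
      by (rule obtain_full_shift)
    then show "M \<in> ?h ` ?X" by (intro image_eqI[of _ _ "(k, a, N)"]) auto
  qed
  ultimately have "bij_betw ?h ?X {M. connected_set (with_proj (KP m n)) M}"
    by (simp add: bij_betw_def)
  then have "(\<Sum>M | connected_set (with_proj (KP m n)) M. g (card M)) = (\<Sum>x\<in>?X. g (card (?h x)))"
    by (rule sum.reindex_bij_betw[symmetric])
  also have "\<dots> = (\<Sum>(k, a, M)\<in>?X. g (card M))"
    by (intro sum.cong) (auto simp: card_shift)
  also have "\<dots> = (\<Sum>k = 1..n. \<Sum>(a, M)\<in>{..<n + 1 - k} \<times> full m k. g (card M))"
    by (subst sum.Sigma) (auto simp: finite_full)
  also have "\<dots> = (\<Sum>k = 1..n. (real n - real k + 1) * (\<Sum>M\<in>full m k. g (card M)))"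
  proof (rule sum.cong[OF refl])
    fix k assume "k \<in> {1..n}"
    \<comment> \<open>Since \<open>k \<le> n\<close>, the number \<open>n + 1 - k\<close> of offsets
      is not truncated and equals the real factor.\<close>
    then show "(\<Sum>(a, M)\<in>{..<n + 1 - k} \<times> full m k. g (card M)) =
        (real n - real k + 1) * (\<Sum>M\<in>full m k. g (card M))"
      by (simp add: sum.cartesian_product[symmetric] of_nat_diff)
  qed
  finally show ?thesis .
qed

theorem theorem3p6:
  fixes m n :: nat
  assumes "m \<ge> 1" and "n \<ge> 1"
  shows "average_order (KP m n) =
    (\<Sum>k = 1..n. (real n - real k + 1) *
       (real m * real k * real (f m k)
        - (\<Sum>i = 1..m - 1. \<Sum>s = 1..k.
             real (m choose i) * (real m - real i) * real (f_i i m s) * real (f_i i m (k + 1 - s)))))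
    / (\<Sum>k = 1..n. (real n - real k + 1) * real (f m k))"
proof -
  have "real (total_order (KP m n)) =
      (\<Sum>k = 1..n. (real n - real k + 1) * (\<Sum>M\<in>full m k. real (card M)))"
    unfolding total_order_def of_nat_sum by (rule sum_connected_sets_KP)
  also have "\<dots> = (\<Sum>k = 1..n. (real n - real k + 1) *
       (real m * real k * real (f m k)
        - (\<Sum>i = 1..m - 1. \<Sum>s = 1..k.
             real (m choose i) * (real m - real i) * real (f_i i m s) * real (f_i i m (k + 1 - s)))))"
    by (intro sum.cong) (auto simp: sum_card_full f_eq_card_full)
  finally have total: "real (total_order (KP m n)) = \<dots>" .
  \<comment> \<open>The constant weight 1 counts the sets, whereas the numerator used the weight
    \<open>real\<close>.\<close>
  have "real (num_connected_sets (KP m n)) = (\<Sum>k = 1..n. (real n - real k + 1) * real (f m k))"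
    using sum_connected_sets_KP[of "\<lambda>_. 1" m n]
    by (simp add: num_connected_sets_def f_eq_card_full)
  with total show ?thesis by (simp only: average_order_def)
qed

end
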